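(* Let $N,s$ be integers with $0\le s\le N$. Then, as an identity of rational functions in $z$ (equivalently, for all $z\in\mathbb{C}$ with $z^2\neq 1$), $$U_N^{(s)}(z)=(-1)^s2^{-s}\,\frac{s!\,(N+s+1)!}{(N-s)!}\,\frac{1}{(1-z^2)^s}\sum_{j=0}^{s}(-1)^j\frac{(N-j)!}{j!\,(s-j)!\,(N+s+1-j)!}\,U_{N+s-2j}(z).$$
   Context: $U_N(z)=\sum_{j=0}^{[N/2]}(-1)^j\binom{N-j}{j}(2z)^{N-2j}$, for integers $N\ge 0$, is the Chebyshev polynomial of the second kind ($[x]$ is the integer part of $x$), and $U_N^{(s)}$ is its $s$-th derivative. *)

theory Defs
  imports Complex_Main "HOL-Computational_Algebra.Polynomial"
begin

definition Chebyshev_U :: "nat \<Rightarrow> complex poly" where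
  "Chebyshev_U N =
     (\<Sum>j=0..N div 2. smult ((-1) ^ j * of_nat ((N - j) choose j)) ([:0, 2:] ^ (N - 2 * j)))"

lemma poly_Chebyshev_U:
  "poly (Chebyshev_U N) z =
     (\<Sum>j=0..N div 2. (-1) ^ j * of_nat ((N - j) choose j) * (2 * z) ^ (N - 2 * j))"
  by (simp add: Chebyshev_U_def poly_sum mult.commute[of z])

end

theory Submission
  imports Defs
begin

text \<open>
  Multiplying through by \<open>(1 - z\<^sup>2) ^ s\<close>, the claim says that the polynomial
  \<open>F\<^sub>s = (1 - z\<^sup>2) ^ s * U\<^sub>N\<^sup>(\<^sup>s\<^sup>)\<close> is a specific linear combination of
  \<open>U\<^sub>N\<^sub>+\<^sub>s, U\<^sub>N\<^sub>+\<^sub>s\<^sub>-\<^sub>2, \<dots>, U\<^sub>N\<^sub>-\<^sub>s\<close>. The product rule turns one more derivative into a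
  first-order operator acting on the previous polynomial,

    \<open>F\<^sub>s\<^sub>+\<^sub>1 = (1 - z\<^sup>2) * F\<^sub>s' + 2 * s * z * F\<^sub>s\<close>,

  and this operator sends each \<open>U\<^sub>m\<close> to a combination of its two neighbours
  \<open>U\<^sub>m\<^sub>+\<^sub>1\<close> and \<open>U\<^sub>m\<^sub>-\<^sub>1\<close> (lemma \<open>Chebyshev_U_ladder\<close>), because both
  \<open>(1 - z\<^sup>2) * U\<^sub>m'\<close> and \<open>2 * z * U\<^sub>m\<close> do. Hence the coefficients for \<open>s + 1\<close> arise from those
  for \<open>s\<close> by a rule of Pascal type, and it remains to check that the closed form satisfies this
  rule (lemma \<open>deriv_coeff_Suc_Suc\<close> and the two boundary cases).
\<close>

section \<open>Recurrence and differentiation of the Chebyshev polynomials\<close>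

text \<open>
  The binomial coefficient vanishes beyond \<open>N div 2\<close>, so the summation range may be enlarged freely;
  this removes the parity distinction from index shifts.
\<close>
lemma poly_Chebyshev_U_atMost:
  assumes "N \<le> M"
  shows "poly (Chebyshev_U N) z =
    (\<Sum>j\<le>M. (-1) ^ j * of_nat ((N - j) choose j) * (2 * z) ^ (N - 2 * j))"
  unfolding poly_Chebyshev_U
proof (rule sum.mono_neutral_left)
  show "{0..N div 2} \<subseteq> {..M}" using assms by auto
  show "\<forall>i\<in>{..M} - {0..N div 2}. (-1) ^ i * of_nat ((N - i) choose i) * (2 * z) ^ (N - 2 * i) = 0"
    by (auto simp: binomial_eq_0)
qed simp

lemma Chebyshev_U_0: "poly (Chebyshev_U 0) z = 1"
  by (simp add: poly_Chebyshev_U)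

lemma Chebyshev_U_1: "poly (Chebyshev_U (Suc 0)) z = 2 * z"
  by (simp add: poly_Chebyshev_U)

text \<open>The three-term recurrence is Pascal's rule applied to each coefficient.\<close>
lemma Chebyshev_U_Suc_Suc:
  "poly (Chebyshev_U (Suc (Suc n))) z = 2 * z * poly (Chebyshev_U (Suc n)) z - poly (Chebyshev_U n) z"
proof -
  define t where "t N j = (-1) ^ j * of_nat ((N - j) choose j) * (2 * z) ^ (N - 2 * j)" for N j
  have U: "poly (Chebyshev_U N) z = (\<Sum>j\<le>M. t N j)" if "N \<le> M" for N M
    using poly_Chebyshev_U_atMost[OF that] by (simp add: t_def)
  have step: "t (Suc (Suc n)) (Suc j) = 2 * z * t (Suc n) (Suc j) - t n j" if "j \<le> Suc n" for j
  proof (cases "j \<le> n")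
    case True
    then have "Suc n - j = Suc (n - j)" by simp
    moreover have "2 * z * (of_nat ((n - j) choose Suc j) * (2 * z) ^ (n - Suc (2 * j)))
        = of_nat ((n - j) choose Suc j) * (2 * z) ^ (n - 2 * j)"
    proof (cases "2 * j < n")
      case True
      then have "n - 2 * j = Suc (n - Suc (2 * j))" by simp
      then show ?thesis by simp
    next
      case False
      then show ?thesis by (simp add: binomial_eq_0)
    qed
    ultimately show ?thesis
      by (auto simp: t_def algebra_simps)
  next
    case False
    then show ?thesis using that by (simp add: t_def binomial_eq_0)
  qed
  have "poly (Chebyshev_U (Suc (Suc n))) z = t (Suc (Suc n)) 0 + (\<Sum>j\<le>Suc n. t (Suc (Suc n)) (Suc j))"
    by (subst U[of _ "Suc (Suc n)"]) (simp_all only: sum.atMost_Suc_shift order_refl)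
  also have "t (Suc (Suc n)) 0 = 2 * z * t (Suc n) 0"
    by (simp add: t_def)
  also have "(\<Sum>j\<le>Suc n. t (Suc (Suc n)) (Suc j)) = (\<Sum>j\<le>Suc n. 2 * z * t (Suc n) (Suc j) - t n j)"
    by (rule sum.cong) (use step in auto)
  also have "2 * z * t (Suc n) 0 + \<dots> =
      2 * z * (t (Suc n) 0 + (\<Sum>j\<le>Suc n. t (Suc n) (Suc j))) - (\<Sum>j\<le>Suc n. t n j)"
    by (simp only: sum_subtractf sum_distrib_left algebra_simps)
  also have "t (Suc n) 0 + (\<Sum>j\<le>Suc n. t (Suc n) (Suc j)) = poly (Chebyshev_U (Suc n)) z"
    using U[of "Suc n" "Suc (Suc n)"] by (simp only: sum.atMost_Suc_shift)
  also have "(\<Sum>j\<le>Suc n. t n j) = poly (Chebyshev_U n) z"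
    by (subst U[of _ "Suc n"]) simp_all
  finally show ?thesis .
qed

text \<open>
  Equivalent to the symmetric form \<open>2 * (1 - z\<^sup>2) * U\<^sub>n' = (n + 2) * U\<^sub>n\<^sub>-\<^sub>1 - n * U\<^sub>n\<^sub>+\<^sub>1\<close>, but free of
  \<open>U\<^sub>n\<^sub>-\<^sub>1\<close>, so that it makes sense for \<open>n = 0\<close> too.
\<close>
lemma Chebyshev_U_pderiv:
  "(1 - z\<^sup>2) * poly (pderiv (Chebyshev_U n)) z =
    (of_nat n + 2) * z * poly (Chebyshev_U n) z - (of_nat n + 1) * poly (Chebyshev_U (Suc n)) z"
proof (induction n rule: induct_nat_012)
  case 0
  have "Chebyshev_U 0 = 1"
    by (intro poly_eq_poly_eq_iff[THEN iffD1] ext) (simp add: Chebyshev_U_0)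
  then show ?case by (simp add: Chebyshev_U_1)
next
  case 1
  have "Chebyshev_U (Suc 0) = [:0, 2:]"
    by (intro poly_eq_poly_eq_iff[THEN iffD1] ext) (simp add: Chebyshev_U_1)
  then show ?case
    by (simp add: Chebyshev_U_Suc_Suc Chebyshev_U_0 pderiv_pCons algebra_simps power2_eq_square)
next
  case (ge2 n)
  define u v where "u = poly (Chebyshev_U n) z" and "v = poly (Chebyshev_U (Suc n)) z"
  have "Chebyshev_U (Suc (Suc n)) = [:0, 2:] * Chebyshev_U (Suc n) - Chebyshev_U n"
    by (intro poly_eq_poly_eq_iff[THEN iffD1] ext) (simp add: Chebyshev_U_Suc_Suc)
  then have "(1 - z\<^sup>2) * poly (pderiv (Chebyshev_U (Suc (Suc n)))) z =
      2 * (1 - z\<^sup>2) * v + 2 * z * ((1 - z\<^sup>2) * poly (pderiv (Chebyshev_U (Suc n))) z)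
      - (1 - z\<^sup>2) * poly (pderiv (Chebyshev_U n)) z"
    by (simp only: pderiv_diff pderiv_mult) (simp add: pderiv_pCons v_def algebra_simps)
  also have "\<dots> = 2 * (1 - z\<^sup>2) * v
      + 2 * z * ((of_nat n + 3) * z * v - (of_nat n + 2) * (2 * z * v - u))
      - ((of_nat n + 2) * z * u - (of_nat n + 1) * v)"
    unfolding ge2.IH by (simp add: u_def v_def Chebyshev_U_Suc_Suc add.commute)
  also have "\<dots> = (of_nat n + 4) * z * (2 * z * v - u) - (of_nat n + 3) * (2 * z * (2 * z * v - u) - v)"
    by (simp add: algebra_simps power2_eq_square)
  finally show ?case
    by (simp add: u_def v_def Chebyshev_U_Suc_Suc add.commute)
qed

text \<open>
  The operator \<open>(1 - z\<^sup>2) * d/dz + 2 * t * z\<close>, through which the polynomials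
  \<open>(1 - z\<^sup>2) ^ s * U\<^sub>N\<^sup>(\<^sup>s\<^sup>)\<close> are linked, maps a Chebyshev polynomial into the span of its neighbours.
\<close>
lemma Chebyshev_U_ladder:
  fixes t :: complex
  shows "(1 - z\<^sup>2) * poly (pderiv (Chebyshev_U (Suc m))) z + 2 * t * z * poly (Chebyshev_U (Suc m)) z =
    (t - (of_nat m + 1) / 2) * poly (Chebyshev_U (Suc (Suc m))) z
    + (t + (of_nat m + 3) / 2) * poly (Chebyshev_U m) z"
  unfolding Chebyshev_U_pderiv
  by (simp add: Chebyshev_U_Suc_Suc field_simps)

section \<open>The coefficients\<close>

definition deriv_coeff :: "nat \<Rightarrow> nat \<Rightarrow> nat \<Rightarrow> complex" where
  "deriv_coeff N s j = (-1) ^ s * (1 / 2 ^ s) * ((fact s * fact (N + s + 1)) / fact (N - s)) *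
     ((-1) ^ j * (fact (N - j) / (fact j * fact (s - j) * fact (N + s + 1 - j))))"

text \<open>
  The next two factors are those of the ladder relation with \<open>t = s\<close> and
  \<open>m + 1 = N + s - 2 * j\<close>. As the degrees for \<open>s + 1\<close> are \<open>N + s + 1 - 2 * j\<close>, the upper
  neighbour keeps the position \<open>j\<close>, while the lower one moves to position \<open>j + 1\<close>.
\<close>
definition up_factor :: "nat \<Rightarrow> nat \<Rightarrow> nat \<Rightarrow> complex" where
  "up_factor N s j = (of_nat s - of_nat N) / 2 + of_nat j"

definition down_factor :: "nat \<Rightarrow> nat \<Rightarrow> nat \<Rightarrow> complex" where
  "down_factor N s j = (of_nat N + 3 * of_nat s) / 2 + 1 - of_nat j"

lemma deriv_coeff_Suc_0:
  assumes "s < N"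
  shows "deriv_coeff N (Suc s) 0 = up_factor N s 0 * deriv_coeff N s 0"
proof -
  obtain e where N: "N = Suc (s + e)" using assms less_iff_Suc_add by auto
  have "N - s = Suc e" "N - Suc s = e" using N by auto
  then show ?thesis
    unfolding deriv_coeff_def up_factor_def
    by (simp add: N divide_simps del: of_nat_Suc) (simp add: algebra_simps)
qed

lemma deriv_coeff_Suc_diag:
  assumes "s < N"
  shows "deriv_coeff N (Suc s) (Suc s) = down_factor N s s * deriv_coeff N s s"
proof -
  obtain e where N: "N = Suc (s + e)" using assms less_iff_Suc_add by auto
  have "N - s = Suc e" "N - Suc s = e" using N by auto
  then show ?thesis
    unfolding deriv_coeff_def down_factor_def
    by (simp add: N divide_simps del: of_nat_Suc) (simp add: algebra_simps)
qed

text \<open>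
  After division by the common factorials the rule becomes a polynomial identity in \<open>N\<close>, \<open>s\<close> and
  \<open>i = j + 1\<close>: the expression
  \<open>(N - s - 2 * i) * (s + 1 - i) * (N + s + 2 - i) + (N + 3 * s + 4 - 2 * i) * (N + 1 - i) * i\<close>
  does not depend on \<open>i\<close>, and equals \<open>(s + 1) * (N - s) * (N + s + 2)\<close>.
\<close>
lemma deriv_coeff_Suc_Suc:
  assumes "s < N" "j < s"
  shows "deriv_coeff N (Suc s) (Suc j) =
    up_factor N s (Suc j) * deriv_coeff N s (Suc j) + down_factor N s j * deriv_coeff N s j"
proof -
  obtain d where s: "s = Suc (j + d)" using assms less_iff_Suc_add by auto
  obtain e where N: "N = Suc (s + e)" using assms less_iff_Suc_add by auto
  define x y w :: complex where "x = of_nat j" and "y = of_nat d" and "w = of_nat e"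
  \<comment> \<open>\<open>A\<close> collects what the three coefficients share; what is left of each is rational in \<open>j\<close>, \<open>d\<close>, \<open>e\<close>.\<close>
  define A :: complex where "A = (-1) ^ s * (1 / 2 ^ s) * fact s * fact (N + s + 1) * (-1) ^ j
    * fact (d + e + 1) / (fact e * fact j * fact d * fact (j + 2 * d + e + 3))"
  have nz: "1 + of_nat k \<noteq> (0 :: complex)" for k
    by (metis of_nat_Suc of_nat_neq_0)
  have nz': "w + 1 \<noteq> 0" "x + 1 \<noteq> 0" "y + 1 \<noteq> 0" "x + 2 * y + w + 4 \<noteq> 0"
    using nz[of e] nz[of j] nz[of d] nz[of "j + 2 * d + e + 3"]
    by (simp_all add: x_def y_def w_def add_ac)
  have c0: "deriv_coeff N s j =
      A * (y + w + 2) / ((w + 1) * (y + 1) * (x + 2 * y + w + 4))"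
    and c1: "deriv_coeff N s (Suc j) = - A / ((w + 1) * (x + 1))"
    and c2: "deriv_coeff N (Suc s) (Suc j) =
      A * (x + y + 2) * (2 * x + 2 * y + w + 5) / (2 * (x + 1) * (y + 1) * (x + 2 * y + w + 4))"
  proof -
    have idx: "N - s = Suc e" "N - Suc s = e" "N - j = Suc (d + e + 1)" "N - Suc j = d + e + 1"
      "s - j = Suc d" "s - Suc j = d" "Suc s - Suc j = Suc d"
      "N + s + 1 - j = Suc (j + 2 * d + e + 3)" "N + s + 1 - Suc j = j + 2 * d + e + 3"
      "N + Suc s + 1 = Suc (N + s + 1)" "Suc (N + s + 1) - Suc j = Suc (j + 2 * d + e + 3)"
      by (simp_all add: N s)
    have fct: "fact (Suc e) = (w + 1) * fact e" "fact (Suc j) = (x + 1) * fact j"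
      "fact (Suc d) = (y + 1) * fact d"
      "fact (Suc (d + e + 1)) = (y + w + 2) * fact (d + e + 1)"
      "fact (Suc (j + 2 * d + e + 3)) = (x + 2 * y + w + 4) * fact (j + 2 * d + e + 3)"
      "fact (Suc s) = (x + y + 2) * fact s"
      "fact (Suc (N + s + 1)) = (2 * x + 2 * y + w + 5) * fact (N + s + 1)"
      unfolding fact_Suc by (simp_all add: N s x_def y_def w_def add_ac del: fact_Suc)
    show "deriv_coeff N s j = A * (y + w + 2) / ((w + 1) * (y + 1) * (x + 2 * y + w + 4))"
      "deriv_coeff N s (Suc j) = - A / ((w + 1) * (x + 1))"
      "deriv_coeff N (Suc s) (Suc j) =
      A * (x + y + 2) * (2 * x + 2 * y + w + 5) / (2 * (x + 1) * (y + 1) * (x + 2 * y + w + 4))"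
      unfolding deriv_coeff_def idx fct A_def using nz' by (simp_all add: field_simps del: fact_Suc)
  qed
  have f: "up_factor N s (Suc j) = (2 * x + 1 - w) / 2"
    "down_factor N s j = (2 * x + 4 * y + w + 7) / 2"
    by (simp_all add: up_factor_def down_factor_def N s x_def y_def w_def field_simps)
  show ?thesis
    unfolding c0 c1 c2 f using nz' by (simp add: divide_simps) algebra
qed

section \<open>The expansion of the derivatives\<close>

lemma Chebyshev_U_higher_pderiv:
  assumes "s \<le> N"
  shows "(1 - z\<^sup>2) ^ s * poly ((pderiv ^^ s) (Chebyshev_U N)) z =
    (\<Sum>j\<le>s. deriv_coeff N s j * poly (Chebyshev_U (N + s - 2 * j)) z)"
  using assms
proof (induction s arbitrary: z)
  case 0
  then show ?case by (simp add: deriv_coeff_def del: fact_Suc)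
next
  case (Suc s)
  define D where "D = (pderiv ^^ s) (Chebyshev_U N)"
  define c where "c = deriv_coeff N s"
  define V where "V j = poly (Chebyshev_U (N + Suc s - 2 * j)) z" for j
  let ?F = "\<Sum>j\<le>s. smult (c j) (Chebyshev_U (N + s - 2 * j))"
  have IH: "(1 - w\<^sup>2) ^ s * poly D w = poly ?F w" for w
    using Suc by (simp add: D_def c_def poly_sum)
  have "[:1, 0, -1:] ^ s * D = ?F"
    by (intro poly_eq_poly_eq_iff[THEN iffD1] ext)
      (simp add: IH[symmetric] power2_eq_square)
  then have "poly (pderiv ([:1, 0, -1:] ^ s * D)) z = poly (pderiv ?F) z"
    by simp
  moreover have "(1 - z\<^sup>2) * poly (pderiv ([:1, 0, -1:] ^ s * D)) z =
      (1 - z\<^sup>2) ^ Suc s * poly (pderiv D) z - 2 * of_nat s * z * ((1 - z\<^sup>2) ^ s * poly D z)"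
  proof (cases s)
    case (Suc r)
    have "pderiv ([:1, 0, -1:] ^ s * D) = [:1, 0, -1:] ^ s * pderiv D
        + D * (smult (of_nat s) ([:1, 0, -1:] ^ r) * [:0, -2:])"
      unfolding Suc pderiv_mult pderiv_power_Suc by (simp add: pderiv_pCons)
    then have "poly (pderiv ([:1, 0, -1:] ^ s * D)) z = (1 - z\<^sup>2) ^ s * poly (pderiv D) z
        - 2 * of_nat s * z * (1 - z\<^sup>2) ^ r * poly D z"
      by (simp only: poly_add poly_mult poly_power poly_smult) (simp add: power2_eq_square)
    then show ?thesis
      by (simp add: Suc right_diff_distrib mult_ac)
  qed simp
  ultimately have "(1 - z\<^sup>2) ^ Suc s * poly (pderiv D) z =
      (1 - z\<^sup>2) * poly (pderiv ?F) z + 2 * of_nat s * z * poly ?F z"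
    using IH[of z] by (simp add: algebra_simps)
  also have "\<dots> = (\<Sum>j\<le>s. c j * ((1 - z\<^sup>2) * poly (pderiv (Chebyshev_U (N + s - 2 * j))) z
      + 2 * of_nat s * z * poly (Chebyshev_U (N + s - 2 * j)) z))"
    by (simp add: higher_pderiv_sum[of 1, simplified] pderiv_smult poly_sum sum_distrib_left
        sum.distrib distrib_left mult_ac)
  also have "\<dots> = (\<Sum>j\<le>s. up_factor N s j * c j * V j + down_factor N s j * c j * V (Suc j))"
  proof (rule sum.cong)
    fix j assume "j \<in> {..s}"
    \<comment> \<open>Since \<open>j \<le> s < N\<close>, the index is positive and the lower neighbour exists.\<close>
    then have "2 * j < N + s" using Suc.prems by auto
    then obtain m where m: "N + s = Suc (2 * j + m)" using less_iff_Suc_add by auto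
    then have ind: "N + s - 2 * j = Suc m" "N + Suc s - 2 * j = Suc (Suc m)"
      "N + Suc s - 2 * Suc j = m" by auto
    have "(of_nat N + of_nat s :: complex) = 1 + 2 * of_nat j + of_nat m"
      using arg_cong[OF m, of "of_nat :: nat \<Rightarrow> complex"] by simp
    then have N: "(of_nat N :: complex) = 1 + 2 * of_nat j + of_nat m - of_nat s"
      by (simp add: algebra_simps)
    have f: "up_factor N s j = of_nat s - (of_nat m + 1) / 2"
      "down_factor N s j = of_nat s + (of_nat m + 3) / 2"
      unfolding up_factor_def down_factor_def N by (simp_all add: field_simps)
    show "c j * ((1 - z\<^sup>2) * poly (pderiv (Chebyshev_U (N + s - 2 * j))) z
        + 2 * of_nat s * z * poly (Chebyshev_U (N + s - 2 * j)) z)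
      = up_factor N s j * c j * V j + down_factor N s j * c j * V (Suc j)"
      unfolding V_def ind f Chebyshev_U_ladder by (simp add: algebra_simps)
  qed simp
  also have "\<dots> = up_factor N s 0 * c 0 * V 0
      + (\<Sum>j<s. (up_factor N s (Suc j) * c (Suc j) + down_factor N s j * c j) * V (Suc j))
      + down_factor N s s * c s * V (Suc s)"
    using sum.atMost_shift[of "\<lambda>j. up_factor N s j * c j * V j" s]
      sum.lessThan_Suc[of "\<lambda>j. down_factor N s j * c j * V (Suc j)" s]
    by (simp add: sum.distrib distrib_right lessThan_Suc_atMost add_ac)
  also have "\<dots> = deriv_coeff N (Suc s) 0 * V 0
      + (\<Sum>j<s. deriv_coeff N (Suc s) (Suc j) * V (Suc j))
      + deriv_coeff N (Suc s) (Suc s) * V (Suc s)"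
    using Suc.prems
    by (simp add: c_def deriv_coeff_Suc_0 deriv_coeff_Suc_diag deriv_coeff_Suc_Suc)
  also have "\<dots> = (\<Sum>j\<le>Suc s. deriv_coeff N (Suc s) j * V j)"
    by (simp add: sum.atMost_shift)
  finally show ?case
    by (simp add: D_def V_def)
qed

theorem theorem6p1:
  fixes N s :: nat and z :: complex
  assumes "s \<le> N" and "z\<^sup>2 \<noteq> 1"
  shows "poly ((pderiv ^^ s) (Chebyshev_U N)) z =
    (-1) ^ s * (1 / 2 ^ s) * ((fact s * fact (N + s + 1)) / fact (N - s)) * (1 / (1 - z\<^sup>2) ^ s) *
    (\<Sum>j=0..s. (-1) ^ j * (fact (N - j) / (fact j * fact (s - j) * fact (N + s + 1 - j))) *
                poly (Chebyshev_U (N + s - 2 * j)) z)"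
proof -
  have "(1 - z\<^sup>2) ^ s \<noteq> 0"
    using assms(2) by simp
  then have "poly ((pderiv ^^ s) (Chebyshev_U N)) z =
      1 / (1 - z\<^sup>2) ^ s * (\<Sum>j\<le>s. deriv_coeff N s j * poly (Chebyshev_U (N + s - 2 * j)) z)"
    using Chebyshev_U_higher_pderiv[OF assms(1), of z] by (simp add: field_simps)
  then show ?thesis
    by (simp only: deriv_coeff_def sum_distrib_left atMost_atLeast0 mult_ac)
qed

end
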